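(* Let $n\in\mathbb N=\{1,2,3,\dots\}$, let $a,b_1,\dots,b_n,c_1,\dots,c_n$ be complex parameters with $c_k\notin\{0,-1,-2,\dots\}$ for all $k$, and let $x_1,\dots,x_n$ satisfy $|x_1|+\dots+|x_n|<1$. Then $$ F_A^{(n)}\left[\begin{matrix} a,b_1,\dots,b_n;\\ c_1,\dots,c_n;\end{matrix}\; x_1,\dots,x_n\right] =\sum_{\substack{m_{i,j}=0\\ (2\le i\le j\le n)}}^{\infty}\frac{(a)_{N_2(n,n)}}{\prod_{2\le i\le j\le n} m_{i,j}!}\;\prod_{k=1}^{n}\frac{(b_k)_{M_2(k,n)}}{(c_k)_{M_2(k,n)}}\,x_k^{M_2(k,n)}\,F\left[\begin{matrix} a+N_2(k,n),\,b_k+M_2(k,n);\\ c_k+M_2(k,n);\end{matrix}\; x_k\right], $$ where the sum runs over all families of non-negative integers $(m_{i,j})_{2\le i\le j\le n}$, and, for each such family, $$ M_2(k,n)=\sum_{i=2}^{k}m_{i,k}+\sum_{i=k+1}^{n}m_{k+1,i},\qquad N_2(k,n)=\sum_{i=2}^{k+1}\sum_{j=i}^{n}m_{i,j}\qquad(1\le k\le n). $$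
   Context: $(\kappa)_\nu=\Gamma(\kappa+\nu)/\Gamma(\kappa)$ is the Pochhammer symbol: $(\kappa)_0=1$ (also for $\kappa=0$) and $(\kappa)_l=\kappa(\kappa+1)\cdots(\kappa+l-1)$ for $l\in\mathbb N$. The Gauss hypergeometric function is $$F\left[\begin{matrix} a,b;\\ c;\end{matrix}\; x\right]=\sum_{k=0}^\infty\frac{(a)_k(b)_k}{k!\,(c)_k}x^k,\qquad |x|<1.$$ The Lauricella function of $n$ variables is $$F_A^{(n)}\left[\begin{matrix} a,b_1,\dots,b_n;\\ c_1,\dots,c_n;\end{matrix}\; x_1,\dots,x_n\right]=\sum_{m_1,\dots,m_n=0}^\infty\frac{(a)_{m_1+\dots+m_n}(b_1)_{m_1}\cdots(b_n)_{m_n}}{m_1!\cdots m_n!\,(c_1)_{m_1}\cdots(c_n)_{m_n}}x_1^{m_1}\cdots x_n^{m_n},\qquad |x_1|+\dots+|x_n|<1.$$ Empty sums are $0$ and empty products are $1$. In particular, for $n=1$ there are no summation indices $m_{i,j}$, the outer sum consists of a single term, and $M_2(1,1)=N_2(1,1)=0$. *)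

theory Defs
  imports "HOL-Analysis.Analysis" "HOL-Library.Nonpos_Ints"
begin

text \<open>The parameters of all series are families indexed by \<open>{1..n}\<close>; only the values at
  these indices matter. Families of summation indices are extensional functions
  (\<^const>\<open>PiE\<close>), so that every family is counted exactly once.\<close>

definition gauss_F :: "complex \<Rightarrow> complex \<Rightarrow> complex \<Rightarrow> complex \<Rightarrow> complex" where
  "gauss_F a b c x = (\<Sum>k. pochhammer a k * pochhammer b k / (fact k * pochhammer c k) * x ^ k)"

definition lauricella_FA ::
  "nat \<Rightarrow> complex \<Rightarrow> (nat \<Rightarrow> complex) \<Rightarrow> (nat \<Rightarrow> complex) \<Rightarrow> (nat \<Rightarrow> complex) \<Rightarrow> complex" where
  "lauricella_FA n a b c x =
     (\<Sum>\<^sub>\<infinity>m\<in>{1..n} \<rightarrow>\<^sub>E (UNIV :: nat set).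
        pochhammer a (\<Sum>k=1..n. m k) * (\<Prod>k=1..n. pochhammer (b k) (m k)) /
        ((\<Prod>k=1..n. fact (m k)) * (\<Prod>k=1..n. pochhammer (c k) (m k))) *
        (\<Prod>k=1..n. x k ^ m k))"

definition idx2 :: "nat \<Rightarrow> (nat \<times> nat) set" where
  "idx2 n = {(i, j). 2 \<le> i \<and> i \<le> j \<and> j \<le> n}"

definition M2 :: "(nat \<times> nat \<Rightarrow> nat) \<Rightarrow> nat \<Rightarrow> nat \<Rightarrow> nat" where
  "M2 m k n = (\<Sum>i=2..k. m (i, k)) + (\<Sum>i=k+1..n. m (k+1, i))"

definition N2 :: "(nat \<times> nat \<Rightarrow> nat) \<Rightarrow> nat \<Rightarrow> nat \<Rightarrow> nat" where
  "N2 m k n = (\<Sum>i=2..k+1. \<Sum>j=i..n. m (i, j))"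

end

theory Submission
  imports Defs
begin

text \<open>Writing out the Gauss series \<open>F[a + N\<^sub>k, b\<^sub>k + M\<^sub>k; c\<^sub>k + M\<^sub>k; x\<^sub>k]\<close> with summation indices
  \<open>p\<^sub>k\<close> turns the right-hand side into a series over all pairs \<open>(m, p)\<close>. Since
  \<open>(b)\<^sub>M (b + M)\<^sub>p = (b)\<^sub>M\<^sub>+\<^sub>p\<close>, the parameters \<open>b\<close> and \<open>c\<close> and the variables enter only through
  \<open>q\<^sub>k = M\<^sub>k + p\<^sub>k\<close>, in exactly the way in which they enter the term of the Lauricella series with
  index \<open>q\<close>. So the theorem amounts to an identity between coefficients,
  \<open>\<Sum>\<^sub>m (a)\<^sub>N \<Prod>\<^sub>k (a + N\<^sub>k)\<^sub>p / (\<Prod> m! \<Prod>\<^sub>k p\<^sub>k!) = (a)\<^sub>\<bar>\<^sub>q\<^sub>\<bar> / \<Prod>\<^sub>k q\<^sub>k!\<close> with \<open>p\<^sub>k = q\<^sub>k - M\<^sub>k\<close> and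
  \<open>N = N\<^sub>n\<close>, for each fixed \<open>q\<close>, and to a rearrangement of the series.

  The identity (\<open>sum_coeff_split\<close>) is a Burchnall-Chaundy expansion, iterated over the variables.
  The indices \<open>m\<^sub>2\<^sub>,\<^sub>j\<close> of the first row couple the variable \<open>x\<^sub>1\<close> to the others: their sum \<open>r\<close> is
  \<open>M\<^sub>1 = N\<^sub>1\<close>, and removing them leaves an expansion of the same kind for \<open>x\<^sub>2, \<dots>, x\<^sub>n\<close> with \<open>a\<close>
  replaced by \<open>a + r\<close>. For the coupling of one variable to all others only two Vandermonde
  identities are needed: \<open>sum_prod_binomial_compositions\<close>, which collects the indices with the
  same sum \<open>r\<close>, and \<open>pochhammer_shift_expansion\<close>, which sums over \<open>r\<close>.

  The rearrangement (\<open>lauricella_has_sum_split_exponents\<close>) needs absolute convergence of the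
  series over \<open>(m, p)\<close>. Replacing \<open>a\<close> by \<open>\<bar>a\<bar>\<close> and all other factors by their absolute values
  gives a majorant with nonnegative coefficients, to which the same identity applies; it is
  therefore reduced to the absolute convergence of Lauricella series
  (\<open>lauricella_abs_summable\<close>), which follows from the multinomial theorem.\<close>

section \<open>Sums over compositions of a number\<close>

definition compositions :: "'k set \<Rightarrow> nat \<Rightarrow> ('k \<Rightarrow> nat) set" where
  "compositions K r = {u \<in> K \<rightarrow>\<^sub>E UNIV. sum u K = r}"

lemma finite_bounded_PiE:
  fixes B :: "'k \<Rightarrow> nat"
  assumes "finite K"
  shows "finite {u \<in> K \<rightarrow>\<^sub>E UNIV. \<forall>k\<in>K. u k \<le> B k}"
  by (rule finite_subset[of _ "PiE K (\<lambda>k. {..B k})"]) (use assms in \<open>auto intro!: finite_PiE\<close>)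

lemma finite_compositions: "finite K \<Longrightarrow> finite (compositions K r)"
  by (rule finite_subset[OF _ finite_bounded_PiE[where B = "\<lambda>_. r"]])
     (auto simp: compositions_def intro: member_le_sum)

lemma sum_compositions_insert:
  fixes K :: "'k set"
  assumes "finite K" "k0 \<notin> K"
  shows "(\<Sum>u\<in>compositions (insert k0 K) r. g u)
       = (\<Sum>i\<le>r. \<Sum>u\<in>compositions K (r - i). g (u(k0 := i)))"
proof -
  have upd: "(\<Sum>k\<in>K. if k = k0 then i else u k) = sum u K" for u :: "'k \<Rightarrow> nat" and i
    using assms(2) by (intro sum.cong) auto
  have "(\<Sum>i\<le>r. \<Sum>u\<in>compositions K (r - i). g (u(k0 := i)))
      = (\<Sum>(i,u)\<in>Sigma {..r} (\<lambda>i. compositions K (r - i)). g (u(k0 := i)))"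
    using assms by (intro sum.Sigma) (auto intro: finite_compositions)
  also have "\<dots> = (\<Sum>u\<in>compositions (insert k0 K) r. g u)"
    by (rule sum.reindex_bij_witness
         [where j = "\<lambda>(i,u). u(k0 := i)" and i = "\<lambda>u. (u k0, u(k0 := undefined))"])
       (use assms in \<open>auto simp: compositions_def upd PiE_def extensional_def fun_eq_iff\<close>)
  finally show ?thesis by simp
qed

text \<open>Iterating a convolution law over a finite index set. Both the multinomial theorem
  (\<open>F y r = y ^ r / r!\<close>) and the Vandermonde identity for several summands
  (\<open>F q r = q choose r\<close>) are instances.\<close>

lemma sum_prod_compositions:
  fixes K :: "'k set"
    and F :: "'b :: comm_monoid_add \<Rightarrow> nat \<Rightarrow> 'a :: comm_semiring_1"
  assumes "finite K"
    and zero: "\<And>r. F 0 r = (if r = 0 then 1 else 0)"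
    and add: "\<And>y z r. F (y + z) r = (\<Sum>i\<le>r. F y i * F z (r - i))"
  shows "(\<Sum>u\<in>compositions K r. \<Prod>k\<in>K. F (y k) (u k)) = F (sum y K) r"
  using assms(1)
proof (induction K arbitrary: r rule: finite_induct)
  case empty
  have "(compositions {} r :: ('k \<Rightarrow> nat) set) = (if r = 0 then {\<lambda>_. undefined} else {})"
    by (auto simp: compositions_def)
  then show ?case by (simp add: zero)
next
  case (insert k0 K)
  have "(\<Prod>k\<in>insert k0 K. F (y k) ((u(k0 := i)) k)) = F (y k0) i * (\<Prod>k\<in>K. F (y k) (u k))" for u i
    using insert.hyps by (auto intro!: arg_cong2[of _ _ _ _ times] prod.cong)
  then show ?case
    using insert by (simp add: sum_compositions_insert add flip: sum_distrib_left)
qed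

lemma sum_prod_binomial_compositions:
  assumes "finite K"
  shows "(\<Sum>u\<in>compositions K r. \<Prod>k\<in>K. q k choose u k) = sum q K choose r"
  by (rule sum_prod_compositions[OF assms]) (auto simp: vandermonde)

lemma multinomial_compositions:
  fixes y :: "'k \<Rightarrow> 'a :: field_char_0"
  assumes "finite K"
  shows "(\<Sum>u\<in>compositions K r. fact r / (\<Prod>k\<in>K. fact (u k)) * (\<Prod>k\<in>K. y k ^ u k)) = sum y K ^ r"
proof -
  have "(\<Sum>u\<in>compositions K r. \<Prod>k\<in>K. y k ^ u k / fact (u k)) = sum y K ^ r / fact r"
  proof (rule sum_prod_compositions[OF assms])
    fix y z :: 'a and r
    show "(y + z) ^ r / fact r = (\<Sum>i\<le>r. y ^ i / fact i * (z ^ (r - i) / fact (r - i)))"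
      by (simp add: binomial_ring binomial_fact sum_divide_distrib divide_simps)
  qed auto
  then have "fact r * (\<Sum>u\<in>compositions K r. \<Prod>k\<in>K. y k ^ u k / fact (u k)) = sum y K ^ r"
    by simp
  then show ?thesis
    by (simp add: sum_distrib_left prod_dividef)
qed

text \<open>After division by \<open>Q!\<close> this is the Vandermonde convolution
  for \<open>p + (a + Q - 1) gchoose Q\<close>, because \<open>(a + r)\<^sub>Q\<^sub>-\<^sub>r / (Q - r)!\<close> is
  \<open>(a + Q - 1) gchoose (Q - r)\<close>: the upper argument does not depend on \<open>r\<close>.\<close>

lemma pochhammer_shift_expansion:
  fixes a :: "'a :: field_char_0"
  shows "(\<Sum>r\<le>p. of_nat (p choose r) * of_nat (Q choose r) * fact r * pochhammer (a + of_nat r) (Q - r))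
       = pochhammer (a + of_nat p) Q"
proof -
  have summand: "of_nat (p choose r) * of_nat (Q choose r) * fact r * pochhammer (a + of_nat r) (Q - r)
      = fact Q * ((of_nat p gchoose r) * ((a + of_nat Q - 1) gchoose (Q - r)))" if "r \<le> Q" for r
  proof -
    have "(a + of_nat Q - 1) gchoose (Q - r) = pochhammer (a + of_nat r) (Q - r) / fact (Q - r)"
      using that by (simp add: gbinomial_pochhammer' of_nat_diff algebra_simps)
    then show ?thesis
      using that by (simp add: binomial_gbinomial[symmetric] binomial_fact[OF that, where 'a = 'a])
  qed
  have "pochhammer (a + of_nat p) Q = fact Q * ((of_nat p + (a + of_nat Q - 1)) gchoose Q)"
    by (simp add: gbinomial_pochhammer' algebra_simps)
  also have "\<dots> = (\<Sum>r\<le>Q. fact Q * ((of_nat p gchoose r) * ((a + of_nat Q - 1) gchoose (Q - r))))"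
    by (subst gbinomial_Vandermonde[symmetric]) (simp add: sum_distrib_left atMost_atLeast0)
  also have "\<dots> = (\<Sum>r\<le>Q. of_nat (p choose r) * of_nat (Q choose r) * fact r * pochhammer (a + of_nat r) (Q - r))"
    by (intro sum.cong) (auto simp: summand)
  also have "\<dots> = (\<Sum>r\<le>p. of_nat (p choose r) * of_nat (Q choose r) * fact r * pochhammer (a + of_nat r) (Q - r))"
    by (intro sum.mono_neutral_cong) (auto simp: not_le binomial_eq_0)
  finally show ?thesis ..
qed


section \<open>The summation indices, row by row\<close>

text \<open>The index set and the exponents of the theorem, with the first row \<open>2\<close> replaced by an
  arbitrary row \<open>s\<close>; they belong to the variables \<open>x\<^sub>k\<close> with \<open>s - 1 \<le> k \<le> n\<close>. Letting \<open>s\<close> vary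
  makes an induction possible that peels off one variable, and one row, at a time.\<close>

definition idx_from :: "nat \<Rightarrow> nat \<Rightarrow> (nat \<times> nat) set" where
  "idx_from s n = {(i, j). s \<le> i \<and> i \<le> j \<and> j \<le> n}"

definition M_from :: "nat \<Rightarrow> (nat \<times> nat \<Rightarrow> nat) \<Rightarrow> nat \<Rightarrow> nat \<Rightarrow> nat" where
  "M_from s m k n = (\<Sum>i=s..k. m (i, k)) + (\<Sum>i=k+1..n. m (k+1, i))"

definition N_from :: "nat \<Rightarrow> (nat \<times> nat \<Rightarrow> nat) \<Rightarrow> nat \<Rightarrow> nat \<Rightarrow> nat" where
  "N_from s m k n = (\<Sum>i=s..k+1. \<Sum>j=i..n. m (i, j))"

lemma finite_idx_from: "finite (idx_from s n)"
  by (rule finite_subset[of _ "{..n} \<times> {..n}"]) (auto simp: idx_from_def)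

lemma idx_from_split:
  "idx_from s n = Pair s ` {s..n} \<union> idx_from (Suc s) n"
  "Pair s ` {s..n} \<inter> idx_from (Suc s) n = {}"
  by (auto simp: idx_from_def)

text \<open>The families \<open>m\<close> that can occur together with the exponents \<open>q\<close> of the variables
  \<open>x\<^sub>t, \<dots>, x\<^sub>n\<close>: the remaining exponent \<open>q k - M\<close> is the index of summation of the \<open>k\<close>-th
  Gauss series, so it has to be nonnegative.\<close>

definition fibre :: "nat \<Rightarrow> nat \<Rightarrow> (nat \<Rightarrow> nat) \<Rightarrow> (nat \<times> nat \<Rightarrow> nat) set" where
  "fibre t n q = {m \<in> idx_from (Suc t) n \<rightarrow>\<^sub>E UNIV. \<forall>k\<in>{t..n}. M_from (Suc t) m k n \<le> q k}"

lemma finite_fibre: "finite (fibre t n q)"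
proof (rule finite_subset[OF _ finite_bounded_PiE[OF finite_idx_from, where B = "\<lambda>p. q (snd p)"]],
    intro subsetI CollectI conjI ballI)
  fix m assume m: "m \<in> fibre t n q"
  then show "m \<in> idx_from (Suc t) n \<rightarrow>\<^sub>E UNIV"
    by (simp add: fibre_def)
  fix p assume p: "p \<in> idx_from (Suc t) n"
  obtain i j where ij: "p = (i, j)" by (cases p)
  have "m (i, j) \<le> (\<Sum>i=Suc t..j. m (i, j))"
    using p ij by (intro member_le_sum) (auto simp: idx_from_def)
  also have "\<dots> \<le> M_from (Suc t) m j n"
    by (simp add: M_from_def)
  also have "\<dots> \<le> q j"
    using m p ij by (simp add: fibre_def idx_from_def)
  finally show "m p \<le> q (snd p)"
    by (simp add: ij)
qed

definition first_row :: "nat \<Rightarrow> nat \<Rightarrow> (nat \<Rightarrow> nat) \<Rightarrow> (nat \<times> nat \<Rightarrow> nat) \<Rightarrow> nat \<times> nat \<Rightarrow> nat" where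
  "first_row s n u m = (\<lambda>p\<in>idx_from s n. if fst p = s then u (snd p) else m p)"

lemma first_row_in_PiE [simp]: "first_row s n u m \<in> idx_from s n \<rightarrow>\<^sub>E UNIV"
  by (simp add: first_row_def)

text \<open>The entry \<open>u k\<close> of the new row lies in column \<open>k\<close>, so it adds to the exponent of
  \<open>x\<^sub>k\<close>, while the exponent of the new variable \<open>x\<^sub>t\<close> is the whole row sum.\<close>

lemma M_from_first_row:
  shows "M_from (Suc t) (first_row (Suc t) n u m) t n = sum u {Suc t..n}"
    and "k \<in> {Suc t..n} \<Longrightarrow>
      M_from (Suc t) (first_row (Suc t) n u m) k n = u k + M_from (Suc (Suc t)) m k n"
proof -
  show "M_from (Suc t) (first_row (Suc t) n u m) t n = sum u {Suc t..n}"
    by (auto simp: M_from_def first_row_def idx_from_def intro!: sum.cong)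
  assume k: "k \<in> {Suc t..n}"
  let ?m = "first_row (Suc t) n u m"
  have "(\<Sum>i=Suc t..k. ?m (i, k)) = ?m (Suc t, k) + (\<Sum>i=Suc (Suc t)..k. ?m (i, k))"
    using k by (intro sum.atLeast_Suc_atMost) auto
  also have "\<dots> = u k + (\<Sum>i=Suc (Suc t)..k. m (i, k))"
    using k by (auto simp: first_row_def idx_from_def intro!: arg_cong2[of _ _ _ _ plus] sum.cong)
  finally have *: "(\<Sum>i=Suc t..k. ?m (i, k)) = u k + (\<Sum>i=Suc (Suc t)..k. m (i, k))" .
  have "(\<Sum>i=k+1..n. ?m (k+1, i)) = (\<Sum>i=k+1..n. m (k+1, i))"
    using k by (auto simp: first_row_def idx_from_def intro!: sum.cong)
  with * show "M_from (Suc t) ?m k n = u k + M_from (Suc (Suc t)) m k n"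
    unfolding M_from_def by simp
qed

lemma N_from_first_row:
  shows "N_from (Suc t) (first_row (Suc t) n u m) t n = sum u {Suc t..n}"
    and "k \<in> {Suc t..n} \<Longrightarrow>
      N_from (Suc t) (first_row (Suc t) n u m) k n = sum u {Suc t..n} + N_from (Suc (Suc t)) m k n"
proof -
  let ?m = "first_row (Suc t) n u m"
  have row: "(\<Sum>j=Suc t..n. ?m (Suc t, j)) = sum u {Suc t..n}"
    by (auto simp: first_row_def idx_from_def intro!: sum.cong)
  then show "N_from (Suc t) ?m t n = sum u {Suc t..n}"
    by (simp add: N_from_def)
  assume k: "k \<in> {Suc t..n}"
  have "N_from (Suc t) ?m k n = (\<Sum>j=Suc t..n. ?m (Suc t, j)) + (\<Sum>i=Suc (Suc t)..k+1. \<Sum>j=i..n. ?m (i, j))"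
    unfolding N_from_def using k by (intro sum.atLeast_Suc_atMost) auto
  also have "(\<Sum>i=Suc (Suc t)..k+1. \<Sum>j=i..n. ?m (i, j)) = N_from (Suc (Suc t)) m k n"
    unfolding N_from_def by (auto simp: first_row_def idx_from_def intro!: sum.cong)
  finally show "N_from (Suc t) ?m k n = sum u {Suc t..n} + N_from (Suc (Suc t)) m k n"
    by (simp add: row)
qed

lemma prod_first_row:
  "(\<Prod>p\<in>idx_from s n. h (first_row s n u m p))
     = (\<Prod>j=s..n. h (u j)) * (\<Prod>p\<in>idx_from (Suc s) n. h (m p))"
proof -
  have "(\<Prod>p\<in>idx_from s n. h (first_row s n u m p))
      = (\<Prod>p\<in>Pair s ` {s..n}. h (first_row s n u m p)) * (\<Prod>p\<in>idx_from (Suc s) n. h (first_row s n u m p))"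
    by (subst idx_from_split(1), rule prod.union_disjoint)
       (simp_all add: finite_idx_from idx_from_split(2))
  also have "(\<Prod>p\<in>Pair s ` {s..n}. h (first_row s n u m p)) = (\<Prod>j=s..n. h (u j))"
    by (subst prod.reindex) (auto simp: inj_on_def first_row_def idx_from_def intro!: prod.cong)
  also have "(\<Prod>p\<in>idx_from (Suc s) n. h (first_row s n u m p)) = (\<Prod>p\<in>idx_from (Suc s) n. h (m p))"
    by (auto simp: first_row_def idx_from_def intro!: prod.cong)
  finally show ?thesis .
qed

text \<open>A family is the same as its first row together with its other rows, and the constraint
  on the other rows is of the same kind with \<open>q k\<close> lowered by \<open>u k\<close>.\<close>

lemma sum_fibre_step:
  assumes "t < n"
  shows "(\<Sum>m\<in>fibre t n q. g m)
       = (\<Sum>u | u \<in> {Suc t..n} \<rightarrow>\<^sub>E UNIV \<and> sum u {Suc t..n} \<le> q t \<and> (\<forall>k\<in>{Suc t..n}. u k \<le> q k).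
            \<Sum>m\<in>fibre (Suc t) n (\<lambda>k. q k - u k). g (first_row (Suc t) n u m))"
proof -
  let ?U = "{u \<in> {Suc t..n} \<rightarrow>\<^sub>E UNIV. sum u {Suc t..n} \<le> q t \<and> (\<forall>k\<in>{Suc t..n}. u k \<le> q k)}"
  let ?i = "\<lambda>m. (\<lambda>j\<in>{Suc t..n}. m (Suc t, j), restrict m (idx_from (Suc (Suc t)) n))"
  have split: "{t..n} = insert t {Suc t..n}"
    using assms by auto
  have glue: "first_row (Suc t) n (fst (?i m)) (snd (?i m)) = m"
    if "m \<in> idx_from (Suc t) n \<rightarrow>\<^sub>E UNIV" for m :: "nat \<times> nat \<Rightarrow> nat"
    using that by (auto simp: first_row_def idx_from_def fun_eq_iff PiE_def extensional_def)
  have fibre_iff: "first_row (Suc t) n u m \<in> fibre t n q \<longleftrightarrow> u \<in> ?U \<and> m \<in> fibre (Suc t) n (\<lambda>k. q k - u k)"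
    if "u \<in> {Suc t..n} \<rightarrow>\<^sub>E UNIV" "m \<in> idx_from (Suc (Suc t)) n \<rightarrow>\<^sub>E UNIV" for u m
  proof -
    have "u k + M_from (Suc (Suc t)) m k n \<le> q k
        \<longleftrightarrow> u k \<le> q k \<and> M_from (Suc (Suc t)) m k n \<le> q k - u k" for k
      by linarith
    then show ?thesis
      using that by (auto simp: fibre_def split M_from_first_row)
  qed
  have "finite ?U"
    by (rule finite_subset[OF _ finite_bounded_PiE[where K = "{Suc t..n}" and B = q]]) auto
  then have "(\<Sum>u\<in>?U. \<Sum>m\<in>fibre (Suc t) n (\<lambda>k. q k - u k). g (first_row (Suc t) n u m))
      = (\<Sum>(u, m)\<in>Sigma ?U (\<lambda>u. fibre (Suc t) n (\<lambda>k. q k - u k)). g (first_row (Suc t) n u m))"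
    by (intro sum.Sigma) (auto simp: finite_fibre)
  also have "\<dots> = (\<Sum>m\<in>fibre t n q. g m)"
  proof (rule sum.reindex_bij_witness[where i = ?i and j = "\<lambda>(u, m). first_row (Suc t) n u m"])
    fix m assume m: "m \<in> fibre t n q"
    then have m': "m \<in> idx_from (Suc t) n \<rightarrow>\<^sub>E UNIV" by (simp add: fibre_def)
    show "(case ?i m of (u, m) \<Rightarrow> first_row (Suc t) n u m) = m"
      using glue[OF m'] by simp
    show "?i m \<in> Sigma ?U (\<lambda>u. fibre (Suc t) n (\<lambda>k. q k - u k))"
      using fibre_iff[of "fst (?i m)" "snd (?i m)"] m unfolding glue[OF m'] by simp
  next
    fix p assume p: "p \<in> Sigma ?U (\<lambda>u. fibre (Suc t) n (\<lambda>k. q k - u k))"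
    obtain u m where [simp]: "p = (u, m)" by (cases p)
    have um: "u \<in> {Suc t..n} \<rightarrow>\<^sub>E UNIV" "m \<in> idx_from (Suc (Suc t)) n \<rightarrow>\<^sub>E UNIV"
      using p by (auto simp: fibre_def)
    show "(case p of (u, m) \<Rightarrow> first_row (Suc t) n u m) \<in> fibre t n q"
      using p fibre_iff[OF um] by simp
    show "?i (case p of (u, m) \<Rightarrow> first_row (Suc t) n u m) = p"
      using um by (auto simp: first_row_def idx_from_def fun_eq_iff PiE_def extensional_def)
  qed auto
  finally show ?thesis ..
qed

section \<open>The identity between coefficients\<close>

text \<open>The coefficient that the family \<open>m\<close>, together with the \<open>p k\<close>-th term of the \<open>k\<close>-th Gauss
  series for each \<open>k\<close>, contributes on the right-hand side. The factors with \<open>b\<close>, \<open>c\<close> and \<open>x\<close> are left out: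
  by \<open>(b)\<^sub>M (b + M)\<^sub>p = (b)\<^sub>M\<^sub>+\<^sub>p\<close> they depend on \<open>M + p\<close> only.\<close>

definition coeff_split ::
  "nat \<Rightarrow> nat \<Rightarrow> 'a :: field_char_0 \<Rightarrow> (nat \<times> nat \<Rightarrow> nat) \<Rightarrow> (nat \<Rightarrow> nat) \<Rightarrow> 'a" where
  "coeff_split t n a m p =
     pochhammer a (N_from (Suc t) m n n) / (\<Prod>r\<in>idx_from (Suc t) n. fact (m r)) *
     (\<Prod>k=t..n. pochhammer (a + of_nat (N_from (Suc t) m k n)) (p k) / fact (p k))"


text \<open>Peeling off the first row shifts \<open>a\<close> by the row sum, because that sum is a summand of every
  \<open>N\<close>. This is why the induction below needs \<open>a\<close> to be arbitrary.\<close>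

lemma coeff_split_first_row:
  fixes a :: "'a :: field_char_0"
  assumes "t < n"
  defines "r \<equiv> \<lambda>u. sum u {Suc t..n}"
  shows "coeff_split t n a (first_row (Suc t) n u m) p =
      pochhammer a (r u) * pochhammer (a + of_nat (r u)) (p t) / (fact (p t) * (\<Prod>k=Suc t..n. fact (u k))) *
      coeff_split (Suc t) n (a + of_nat (r u)) m p"
proof -
  let ?m = "first_row (Suc t) n u m" and ?P = "\<lambda>N k. pochhammer (a + of_nat N) (p k) / fact (p k)"
  have "(\<Prod>k=t..n. ?P (N_from (Suc t) ?m k n) k)
      = ?P (N_from (Suc t) ?m t n) t * (\<Prod>k=Suc t..n. ?P (N_from (Suc t) ?m k n) k)"
    using assms(1) by (intro prod.atLeast_Suc_atMost) auto
  also have "\<dots> = ?P (r u) t * (\<Prod>k=Suc t..n. ?P (r u + N_from (Suc (Suc t)) m k n) k)"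
    using assms(1) by (intro arg_cong2[of _ _ _ _ times] prod.cong) (simp_all only: N_from_first_row r_def)
  finally have prods: "(\<Prod>k=t..n. ?P (N_from (Suc t) ?m k n) k)
      = ?P (r u) t * (\<Prod>k=Suc t..n. ?P (r u + N_from (Suc (Suc t)) m k n) k)" .
  have "N_from (Suc t) ?m n n = r u + N_from (Suc (Suc t)) m n n"
    using assms(1) by (simp add: N_from_first_row r_def)
  then show ?thesis
    unfolding coeff_split_def prods prod_first_row[where h = fact]
    by (simp add: pochhammer_product' add.assoc mult_ac)
qed

text \<open>The heart of the matter: for each vector \<open>q\<close> of exponents the finitely many
  contributions add up to the coefficient in the Lauricella series. The induction peels off
  the variable \<open>x\<^sub>t\<close>. By the induction hypothesis the sum over the other rows is a single
  term, which depends on the first row \<open>u\<close> through its sum \<open>r\<close> and through the product of the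
  binomial coefficients \<open>q k choose u k\<close>. Summing over the rows with sum \<open>r\<close> leaves one
  binomial coefficient, and the remaining sum over \<open>r\<close> is
  \<open>pochhammer_shift_expansion\<close>.\<close>

lemma sum_coeff_split:
  fixes a :: "'a :: field_char_0"
  assumes "t \<le> n"
  shows "(\<Sum>m\<in>fibre t n q. coeff_split t n a m (\<lambda>k. q k - M_from (Suc t) m k n))
       = pochhammer a (\<Sum>k=t..n. q k) / (\<Prod>k=t..n. fact (q k))"
  using assms
proof (induction "n - t" arbitrary: t a q)
  case 0
  then have "t = n" by simp
  have "idx_from (Suc n) n = {}"
    by (auto simp: idx_from_def)
  then have "fibre n n q = {\<lambda>_. undefined}"
    by (auto simp: fibre_def M_from_def)
  then show ?case
    by (simp add: \<open>t = n\<close> coeff_split_def N_from_def M_from_def \<open>idx_from (Suc n) n = {}\<close>)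
next
  case (Suc d)
  then have t: "t < n" and d: "d = n - Suc t" by auto
  let ?K = "{Suc t..n}" and ?p = "q t" and ?Q = "\<Sum>k=Suc t..n. q k"
  let ?U = "{u \<in> ?K \<rightarrow>\<^sub>E UNIV. sum u ?K \<le> q t \<and> (\<forall>k\<in>?K. u k \<le> q k)}"
  let ?C = "\<Prod>k\<in>?K. fact (q k) :: 'a"
  let ?S = "\<lambda>r. pochhammer a ?p / (fact (?p - r) * ?C) * pochhammer (a + of_nat r) (?Q - r)"
  have inner: "(\<Sum>m\<in>fibre (Suc t) n (\<lambda>k. q k - u k).
         coeff_split t n a (first_row (Suc t) n u m)
           (\<lambda>k. q k - M_from (Suc t) (first_row (Suc t) n u m) k n))
       = ?S (sum u ?K) * (\<Prod>k\<in>?K. of_nat (q k choose u k))" if u: "u \<in> ?U" for u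
  proof -
    let ?r = "sum u ?K"
    let ?A = "pochhammer a ?r * pochhammer (a + of_nat ?r) (?p - ?r) / (fact (?p - ?r) * (\<Prod>k\<in>?K. fact (u k)))"
    have le: "u k \<le> q k" if "k \<in> ?K" for k using u that by simp
    have "coeff_split t n a (first_row (Suc t) n u m)
           (\<lambda>k. q k - M_from (Suc t) (first_row (Suc t) n u m) k n)
        = ?A * coeff_split (Suc t) n (a + of_nat ?r) m (\<lambda>k. (q k - u k) - M_from (Suc (Suc t)) m k n)" for m
    proof -
      have "coeff_split (Suc t) n (a + of_nat ?r) m
              (\<lambda>k. q k - M_from (Suc t) (first_row (Suc t) n u m) k n)
          = coeff_split (Suc t) n (a + of_nat ?r) m (\<lambda>k. (q k - u k) - M_from (Suc (Suc t)) m k n)"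
        unfolding coeff_split_def
        by (intro arg_cong2[of _ _ _ _ times] prod.cong refl) (simp only: M_from_first_row diff_diff_left)
      then show ?thesis
        unfolding coeff_split_first_row[OF t] by (simp only: M_from_first_row(1))
    qed
    then have "(\<Sum>m\<in>fibre (Suc t) n (\<lambda>k. q k - u k).
         coeff_split t n a (first_row (Suc t) n u m)
           (\<lambda>k. q k - M_from (Suc t) (first_row (Suc t) n u m) k n))
      = ?A * (pochhammer (a + of_nat ?r) (\<Sum>k\<in>?K. q k - u k) / (\<Prod>k\<in>?K. fact (q k - u k)))"
      using Suc.hyps(1)[OF d Suc_leI[OF t], where q = "\<lambda>k. q k - u k" and a = "a + of_nat ?r"]
      by (simp only: sum_distrib_left[symmetric])
    also have "(\<Sum>k\<in>?K. q k - u k) = ?Q - ?r"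
      using le by (intro sum_subtractf_nat) auto
    also have "pochhammer a ?r * pochhammer (a + of_nat ?r) (?p - ?r) = pochhammer a ?p"
      using u by (intro pochhammer_product[symmetric]) simp
    also have "pochhammer a ?p / (fact (?p - ?r) * (\<Prod>k\<in>?K. fact (u k))) *
          (pochhammer (a + of_nat ?r) (?Q - ?r) / (\<Prod>k\<in>?K. fact (q k - u k)))
        = pochhammer a ?p / fact (?p - ?r) * pochhammer (a + of_nat ?r) (?Q - ?r) *
          (\<Prod>k\<in>?K. 1 / (fact (u k) * fact (q k - u k)))"
      by (simp add: prod_dividef prod.distrib)
    also have "(\<Prod>k\<in>?K. 1 / (fact (u k) * fact (q k - u k) :: 'a))
        = (\<Prod>k\<in>?K. of_nat (q k choose u k) / fact (q k))"
      using le by (intro prod.cong) (auto simp: binomial_fact)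
    finally show ?thesis by (simp add: prod_dividef)
  qed
  have "(\<Sum>m\<in>fibre t n q. coeff_split t n a m (\<lambda>k. q k - M_from (Suc t) m k n))
      = (\<Sum>u\<in>?U. ?S (sum u ?K) * (\<Prod>k\<in>?K. of_nat (q k choose u k)))"
    unfolding sum_fibre_step[OF t] by (intro sum.cong refl inner) 
  \<comment> \<open>The bounds \<open>u k \<le> q k\<close> may be dropped: the other terms contain a vanishing binomial coefficient.\<close>
  also have "\<dots> = (\<Sum>u\<in>(\<Union>r\<le>?p. compositions ?K r). ?S (sum u ?K) * (\<Prod>k\<in>?K. of_nat (q k choose u k)))"
    by (intro sum.mono_neutral_left)
       (auto simp: compositions_def not_less intro!: finite_compositions[unfolded compositions_def])
  also have "\<dots> = (\<Sum>r\<le>?p. \<Sum>u\<in>compositions ?K r. ?S (sum u ?K) * (\<Prod>k\<in>?K. of_nat (q k choose u k)))"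
    by (intro sum.UNION_disjoint) (auto simp: compositions_def intro!: finite_compositions[unfolded compositions_def])
  also have "\<dots> = (\<Sum>r\<le>?p. ?S r * of_nat (?Q choose r))"
  proof (intro sum.cong refl)
    fix r
    have "(\<Sum>u\<in>compositions ?K r. ?S (sum u ?K) * (\<Prod>k\<in>?K. of_nat (q k choose u k)))
        = ?S r * of_nat (\<Sum>u\<in>compositions ?K r. \<Prod>k\<in>?K. q k choose u k)"
      by (simp add: sum_distrib_left compositions_def)
    also have "(\<Sum>u\<in>compositions ?K r. \<Prod>k\<in>?K. q k choose u k) = ?Q choose r"
      by (intro sum_prod_binomial_compositions) auto
    finally show "(\<Sum>u\<in>compositions ?K r. ?S (sum u ?K) * (\<Prod>k\<in>?K. of_nat (q k choose u k)))
        = ?S r * of_nat (?Q choose r)" .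
  qed
  also have "\<dots> = (\<Sum>r\<le>?p. pochhammer a ?p / (fact ?p * ?C) *
      (of_nat (?p choose r) * of_nat (?Q choose r) * fact r * pochhammer (a + of_nat r) (?Q - r)))"
    by (intro sum.cong) (auto simp: binomial_fact[of _ "q t"] mult_ac)
  also have "\<dots> = pochhammer a ?p / (fact ?p * ?C) * pochhammer (a + of_nat ?p) ?Q"
    by (simp only: pochhammer_shift_expansion flip: sum_distrib_left)
  also have "\<dots> = pochhammer a (?p + ?Q) / (fact ?p * ?C)"
    by (simp add: pochhammer_product')
  also have "?p + ?Q = (\<Sum>k=t..n. q k)"
    using t by (intro sum.atLeast_Suc_atMost[symmetric]) auto
  also have "fact ?p * ?C = (\<Prod>k=t..n. fact (q k))"
    using t by (intro prod.atLeast_Suc_atMost[symmetric]) auto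
  finally show ?case .
qed

section \<open>Absolute convergence\<close>

lemma norm_pochhammer_le:
  fixes a :: "'a :: real_normed_field"
  shows "norm (pochhammer (a + of_nat N) n) \<le> pochhammer (norm a + of_nat N) n"
proof (induction n)
  case (Suc n)
  have "norm (a + of_nat N + of_nat n) \<le> norm a + of_nat N + of_nat n"
    using norm_triangle_ineq[of a "of_nat (N + n)"] by (simp add: add.assoc flip: of_nat_add)
  with Suc show ?case
    unfolding pochhammer_Suc norm_mult
    by (intro mult_mono order_trans[OF norm_ge_zero Suc]) auto
qed auto

text \<open>The quotient of two consecutive terms tends to \<open>1\<close>, so these quotients grow more slowly than any
  geometric sequence with ratio \<open>t > 1\<close>.\<close>

lemma pochhammer_quotient_bound:
  fixes b c :: complex
  assumes c: "c \<notin> \<int>\<^sub>\<le>\<^sub>0" and t: "1 < t"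
  obtains C where "0 \<le> C" "\<And>n. norm (pochhammer b n / pochhammer c n) \<le> C * t ^ n"
proof -
  \<comment> \<open>Eventually decreasing, hence bounded by one of its first values.\<close>
  define g where "g n = norm (pochhammer b n / pochhammer c n) / t ^ n" for n
  have "(\<lambda>n. norm ((b + of_nat n) / (c + of_nat n))) \<longlonglongrightarrow> 1"
  proof -
    have "filterlim (\<lambda>n. c + of_nat n) at_infinity sequentially"
      by (intro tendsto_add_filterlim_at_infinity[OF tendsto_const] tendsto_of_nat)
    then have "(\<lambda>n. norm (1 + (b - c) / (c + of_nat n))) \<longlonglongrightarrow> norm (1 + 0 :: complex)"
      by (intro tendsto_intros tendsto_divide_0[OF tendsto_const])
    moreover have "1 + (b - c) / (c + of_nat n) = (b + of_nat n) / (c + of_nat n)" for n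
    proof -
      have "c + of_nat n \<noteq> 0"
        using c by (metis add_eq_0_iff2 minus_of_nat_in_nonpos_Ints)
      then show ?thesis by (simp add: field_simps)
    qed
    ultimately show ?thesis by simp
  qed
  then have "eventually (\<lambda>n. norm ((b + of_nat n) / (c + of_nat n)) < t) sequentially"
    using t by (rule order_tendstoD)
  then obtain n0 where n0: "\<And>n. n \<ge> n0 \<Longrightarrow> norm ((b + of_nat n) / (c + of_nat n)) < t"
    by (auto simp: eventually_sequentially)
  have step: "g (Suc n) \<le> g n" if "n \<ge> n0" for n
  proof -
    have "g (Suc n) = g n * (norm ((b + of_nat n) / (c + of_nat n)) / t)"
      by (simp add: g_def pochhammer_Suc norm_mult norm_divide)
    also have "\<dots> \<le> g n * 1"
      using n0[OF that] t by (intro mult_left_mono) (auto simp: g_def)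
    finally show ?thesis by simp
  qed
  have "g n \<le> Max (g ` {..n0})" for n
  proof (cases "n \<le> n0")
    case False
    then have "n0 \<le> n" by simp
    then have "g n \<le> g n0"
      by (induction rule: dec_induct) (auto intro: order_trans step)
    also have "\<dots> \<le> Max (g ` {..n0})" by simp
    finally show ?thesis .
  qed simp
  moreover from this[of 0] have "0 \<le> Max (g ` {..n0})"
    by (rule order_trans[rotated]) (simp add: g_def)
  ultimately show ?thesis
    using t by (intro that[of "Max (g ` {..n0})"]) (auto simp: g_def divide_le_eq)
qed

lemma multinomial_summable:
  fixes y :: "'k \<Rightarrow> real"
  assumes "finite K" "\<And>k. k \<in> K \<Longrightarrow> 0 \<le> y k" "sum y K < 1"
  shows "(\<lambda>u. fact (sum u K) / (\<Prod>k\<in>K. fact (u k)) * (\<Prod>k\<in>K. y k ^ u k)) summable_on (K \<rightarrow>\<^sub>E (UNIV :: nat set))"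
proof -
  let ?f = "\<lambda>u. fact (sum u K) / (\<Prod>k\<in>K. fact (u k)) * (\<Prod>k\<in>K. y k ^ u k)"
  have "?f summable_on (\<Union>r\<in>UNIV. compositions K r)"
  proof (rule summable_on_UnionI[where g = "\<lambda>r. sum y K ^ r"])
    show "(?f has_sum sum y K ^ r) (compositions K r)" for r
    proof (rule has_sum_finiteI)
      show "sum y K ^ r = sum ?f (compositions K r)"
        unfolding multinomial_compositions[OF assms(1), symmetric]
        by (intro sum.cong) (auto simp: compositions_def)
    qed (simp add: finite_compositions assms)
    have "0 \<le> sum y K"
      using assms by (simp add: sum_nonneg)
    then show "(\<lambda>r. sum y K ^ r) summable_on UNIV"
      using assms by (intro norm_summable_imp_summable_on) (simp add: summable_geometric)
  qed (auto simp: disjoint_family_on_def compositions_def assms intro!: mult_nonneg_nonneg prod_nonneg divide_nonneg_nonneg)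
  also have "(\<Union>r\<in>UNIV. compositions K r) = (K \<rightarrow>\<^sub>E UNIV)"
    by (auto simp: compositions_def)
  finally show ?thesis .
qed

text \<open>Room for two factors of growth \<open>t ^ q\<close>, one from the parameter \<open>a\<close> and one from the
  quotients of the \<open>b\<close> and \<open>c\<close>, within the domain of convergence.\<close>

lemma exists_scaling_factor:
  fixes s :: real
  assumes "0 \<le> s" "s < 1"
  obtains t where "1 < t" "t * t * s < 1"
proof -
  have "((\<lambda>t. t * t * s) \<longlongrightarrow> 1 * 1 * s) (at_right 1)"
    by (intro tendsto_intros)
  then have "eventually (\<lambda>t. t * t * s < 1) (at_right 1)"
    using assms by (intro order_tendstoD) auto
  moreover have "eventually (\<lambda>t::real. 1 < t) (at_right 1)"
    by (simp add: eventually_at_right_less)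
  ultimately have "eventually (\<lambda>t. 1 < t \<and> t * t * s < 1) (at_right 1)"
    by eventually_elim auto
  then show ?thesis
    using that by (auto dest: eventually_happens simp: trivial_limit_at_right_real)
qed

text \<open>With \<open>(a)\<^sub>N = O(t\<^sup>N N!)\<close> and \<open>(b)\<^sub>q / (c)\<^sub>q = O(t\<^sup>q)\<close> the series is dominated by the
  multinomial series at the points \<open>t\<^sup>2 \<bar>x\<^sub>k\<bar>\<close>, whose sum is still below \<open>1\<close>.\<close>

lemma lauricella_abs_summable:
  fixes a :: complex and b c x :: "'k \<Rightarrow> complex"
  assumes K: "finite K" and c: "\<And>k. k \<in> K \<Longrightarrow> c k \<notin> \<int>\<^sub>\<le>\<^sub>0" and x: "(\<Sum>k\<in>K. norm (x k)) < 1"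
  shows "(\<lambda>q. norm (pochhammer a (sum q K)) / (\<Prod>k\<in>K. fact (q k)) *
            norm (\<Prod>k\<in>K. pochhammer (b k) (q k) / pochhammer (c k) (q k) * x k ^ q k))
         summable_on (K \<rightarrow>\<^sub>E (UNIV :: nat set))"
proof -
  obtain t where t: "1 < t" "t * t * (\<Sum>k\<in>K. norm (x k)) < 1"
    using exists_scaling_factor[OF _ x] by (auto simp: sum_nonneg)
  have one: "(1::complex) \<notin> \<int>\<^sub>\<le>\<^sub>0" by auto
  \<comment> \<open>The denominator \<open>(1)\<^sub>n = n!\<close> makes this a bound on \<open>(a)\<^sub>n / n!\<close>.\<close>
  obtain A where A: "0 \<le> A" "\<And>n. norm (pochhammer a n / pochhammer 1 n) \<le> A * t ^ n"
    using pochhammer_quotient_bound[OF one t(1)] by blast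
  have "\<exists>C\<ge>0. \<forall>n. norm (pochhammer (b k) n / pochhammer (c k) n) \<le> C * t ^ n" if "k \<in> K" for k
    using pochhammer_quotient_bound[OF c[OF that] t(1)] by blast
  then obtain C where C: "\<And>k. k \<in> K \<Longrightarrow> 0 \<le> C k"
      "\<And>k n. k \<in> K \<Longrightarrow> norm (pochhammer (b k) n / pochhammer (c k) n) \<le> C k * t ^ n"
    by metis
  let ?y = "\<lambda>k. t * t * norm (x k)"
  let ?g = "\<lambda>q. fact (sum q K) / (\<Prod>k\<in>K. fact (q k)) * (\<Prod>k\<in>K. ?y k ^ q k)"
  have "?g summable_on (K \<rightarrow>\<^sub>E (UNIV :: nat set))"
    using t by (intro multinomial_summable K) (auto simp flip: sum_distrib_left)
  then have "(\<lambda>q. (A * (\<Prod>k\<in>K. C k)) * ?g q) summable_on (K \<rightarrow>\<^sub>E (UNIV :: nat set))"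
    by (rule summable_on_cmult_right)
  then show ?thesis
  proof (rule summable_on_comparison_test)
    fix q :: "'k \<Rightarrow> nat"
    let ?n = "sum q K"
    have a: "norm (pochhammer a ?n) \<le> fact ?n * (A * t ^ ?n)"
      using A(2)[of ?n] by (simp add: norm_divide divide_le_eq mult.commute flip: pochhammer_fact)
    have "norm (\<Prod>k\<in>K. pochhammer (b k) (q k) / pochhammer (c k) (q k) * x k ^ q k)
        \<le> (\<Prod>k\<in>K. (C k * t ^ q k) * norm (x k) ^ q k)"
      unfolding prod_norm[symmetric]
      by (intro prod_mono conjI norm_ge_zero)
         (auto simp only: norm_mult norm_power intro!: mult_right_mono C zero_le_power norm_ge_zero)
    also have "\<dots> = (\<Prod>k\<in>K. C k) * (t ^ ?n * (\<Prod>k\<in>K. norm (x k) ^ q k))"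
      by (simp add: prod.distrib power_sum mult.assoc)
    finally have b: "norm (\<Prod>k\<in>K. pochhammer (b k) (q k) / pochhammer (c k) (q k) * x k ^ q k)
        \<le> (\<Prod>k\<in>K. C k) * (t ^ ?n * (\<Prod>k\<in>K. norm (x k) ^ q k))" .
    have "norm (pochhammer a ?n) / (\<Prod>k\<in>K. fact (q k)) *
            norm (\<Prod>k\<in>K. pochhammer (b k) (q k) / pochhammer (c k) (q k) * x k ^ q k)
        \<le> fact ?n * (A * t ^ ?n) / (\<Prod>k\<in>K. fact (q k)) *
            ((\<Prod>k\<in>K. C k) * (t ^ ?n * (\<Prod>k\<in>K. norm (x k) ^ q k)))"
      by (intro mult_mono divide_right_mono a b)
         (use A t in \<open>auto intro!: prod_nonneg divide_nonneg_nonneg mult_nonneg_nonneg\<close>)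
    also have "\<dots> = (A * (\<Prod>k\<in>K. C k)) * ?g q"
      by (simp add: power_mult_distrib prod.distrib power_sum mult_ac)
    finally show "norm (pochhammer a ?n) / (\<Prod>k\<in>K. fact (q k)) *
            norm (\<Prod>k\<in>K. pochhammer (b k) (q k) / pochhammer (c k) (q k) * x k ^ q k)
        \<le> (A * (\<Prod>k\<in>K. C k)) * ?g q" .
  qed (auto intro!: prod_nonneg divide_nonneg_nonneg mult_nonneg_nonneg)
qed

lemma gauss_F_infsum:
  fixes a b c x :: complex
  assumes c: "c \<notin> \<int>\<^sub>\<le>\<^sub>0" and x: "norm x < 1"
  defines "h \<equiv> \<lambda>k. pochhammer a k * pochhammer b k / (fact k * pochhammer c k) * x ^ k"
  shows "(\<lambda>k. norm (h k)) summable_on UNIV" and "infsum h UNIV = gauss_F a b c x"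
proof -
  obtain t where t: "1 < t" "t * t * norm x < 1"
    using exists_scaling_factor[OF _ x] by auto
  have one: "(1::complex) \<notin> \<int>\<^sub>\<le>\<^sub>0" by auto
  obtain A where A: "0 \<le> A" "\<And>n. norm (pochhammer a n / pochhammer 1 n) \<le> A * t ^ n"
    using pochhammer_quotient_bound[OF one t(1)] by blast
  obtain C where C: "0 \<le> C" "\<And>n. norm (pochhammer b n / pochhammer c n) \<le> C * t ^ n"
    using pochhammer_quotient_bound[OF c t(1)] by blast
  have bound: "norm (h k) \<le> A * C * (t * t * norm x) ^ k" for k
  proof -
    have "norm (h k) = norm (pochhammer a k / pochhammer 1 k) * norm (pochhammer b k / pochhammer c k) * norm x ^ k"
      by (simp add: h_def norm_mult norm_divide norm_power flip: pochhammer_fact)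
    also have "\<dots> \<le> (A * t ^ k) * (C * t ^ k) * norm x ^ k"
      using A C t by (intro mult_right_mono mult_mono) auto
    finally show ?thesis by (simp add: power_mult_distrib mult_ac)
  qed
  have "summable (\<lambda>k. A * C * (t * t * norm x) ^ k)"
    using t by (intro summable_mult summable_geometric) simp
  then have summ: "summable (\<lambda>k. norm (h k))"
    by (rule summable_comparison_test'[where N = 0]) (use bound in simp)
  then show "(\<lambda>k. norm (h k)) summable_on UNIV"
    by (intro norm_summable_imp_summable_on) simp
  have "(h has_sum suminf h) UNIV"
    by (rule norm_summable_imp_has_sum[OF summ]) (use summ summable_norm_cancel in blast)
  then show "infsum h UNIV = gauss_F a b c x"
    by (simp add: infsumI gauss_F_def h_def)
qed

lemma pochhammer_norm_nonneg: "0 \<le> pochhammer (norm a) n"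
  by (induction n) (simp_all add: pochhammer_Suc)

section \<open>Rearrangement of the multiple series\<close>

text \<open>All factors other than the Pochhammer symbols of \<open>a\<close> are positive, so the triangle
  inequality allows \<open>a\<close> to be replaced by \<open>\<bar>a\<bar>\<close>.\<close>

lemma norm_coeff_split_le:
  fixes a :: complex
  shows "norm (coeff_split t n a m p) \<le> coeff_split t n (norm a) m p"
proof -
  have "norm (pochhammer (a + of_nat N) k) \<le> pochhammer (norm a + of_nat N) k" for N k
    by (rule norm_pochhammer_le)
  from this this[of 0] have le: "norm (pochhammer a k) \<le> pochhammer (norm a) k"
    "norm (pochhammer (a + of_nat N) k) \<le> pochhammer (norm a + of_nat N) k" for N k
    by simp_all
  show ?thesis
    unfolding coeff_split_def norm_mult norm_divide prod_norm[symmetric]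
    by (intro mult_mono divide_mono prod_mono conjI le)
       (auto intro!: prod_nonneg prod_pos divide_nonneg_nonneg pochhammer_norm_nonneg simp: norm_divide le divide_right_mono)
qed

text \<open>The full multiple series of the right-hand side, with the Gauss series written out. Grouped by
  \<open>q = M + p\<close> its groups are finite and \<open>sum_coeff_split\<close> evaluates them. The grouping is
  legitimate because the series converges absolutely: the absolute values of a group
  are bounded by the contributions for the parameter \<open>\<bar>a\<bar>\<close>, and the same identity, applied
  to \<open>\<bar>a\<bar>\<close>, bounds their sum by a term of an absolutely convergent Lauricella series.\<close>

lemma lauricella_has_sum_split_exponents:
  fixes a :: complex and b c x :: "nat \<Rightarrow> complex"
  assumes "n \<ge> 1"
    and "\<And>k. k \<in> {1..n} \<Longrightarrow> c k \<notin> \<int>\<^sub>\<le>\<^sub>0"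
    and "(\<Sum>k=1..n. norm (x k)) < 1"
  defines "f \<equiv> \<lambda>q. \<Prod>k=1..n. pochhammer (b k) (q k) / pochhammer (c k) (q k) * x k ^ q k"
  shows "((\<lambda>(m, p). coeff_split 1 n a m p * f (\<lambda>k. M_from (Suc 1) m k n + p k))
           has_sum lauricella_FA n a b c x)
         ((idx_from (Suc 1) n \<rightarrow>\<^sub>E UNIV) \<times> ({1..n} \<rightarrow>\<^sub>E UNIV))"
proof -
  let ?Q = "{1..n} \<rightarrow>\<^sub>E (UNIV :: nat set)"
  let ?X = "idx_from (Suc 1) n \<rightarrow>\<^sub>E (UNIV :: nat set)"
  let ?M = "\<lambda>m k. M_from (Suc 1) m k n"
  let ?j = "\<lambda>(m, p). (\<lambda>k\<in>{1..n}. ?M m k + p k, m)"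
  let ?i = "\<lambda>(q, m). (m, \<lambda>k\<in>{1..n}. q k - ?M m k)"
  let ?G = "\<lambda>q. pochhammer a (sum q {1..n}) / (\<Prod>k=1..n. fact (q k)) * f q"
  let ?R = "\<lambda>q. pochhammer (norm a) (sum q {1..n}) / (\<Prod>k=1..n. fact (q k)) * norm (f q)"
  let ?H = "\<lambda>(q, m). coeff_split 1 n a m (\<lambda>k. q k - ?M m k) * f q"
  have summ: "(\<lambda>q. norm (pochhammer z (sum q {1..n})) / (\<Prod>k=1..n. fact (q k)) * norm (f q)) summable_on ?Q"
    for z :: complex
    unfolding f_def by (rule lauricella_abs_summable) (use assms(2,3) in auto)
  have "norm (pochhammer (complex_of_real (norm a)) k) = pochhammer (norm a) k" for k
    by (simp add: pochhammer_of_real pochhammer_norm_nonneg)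
  with summ[of "of_real (norm a)"] have R: "?R summable_on ?Q"
    by simp
  have "norm (\<Prod>k=1..n. fact (q k) :: complex) = (\<Prod>k=1..n. fact (q k))" for q :: "nat \<Rightarrow> nat"
    by (simp flip: prod_norm)
  with summ[of a] have "(\<lambda>q. norm (?G q)) summable_on ?Q"
    by (simp only: norm_mult norm_divide)
  then have "(?G has_sum infsum ?G ?Q) ?Q"
    by (rule has_sum_infsum[OF abs_summable_summable])
  moreover have "infsum ?G ?Q = lauricella_FA n a b c x"
    unfolding lauricella_FA_def f_def
    by (intro infsum_cong) (simp add: prod_dividef prod.distrib)
  ultimately have G: "(?G has_sum lauricella_FA n a b c x) ?Q" by simp
  have inner: "((\<lambda>m. coeff_split 1 n z m (\<lambda>k. q k - ?M m k) * w) has_sum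
      (pochhammer z (sum q {1..n}) / (\<Prod>k=1..n. fact (q k)) * w)) (fibre 1 n q)"
    for q :: "nat \<Rightarrow> nat" and z w :: "'z :: real_normed_field"
    using sum_coeff_split[OF assms(1), of z q]
    by (intro has_sum_finiteI) (simp_all add: finite_fibre flip: sum_distrib_right)
  have "(\<lambda>(q, m). coeff_split 1 n (norm a) m (\<lambda>k. q k - ?M m k) * norm (f q)) summable_on Sigma ?Q (fibre 1 n)"
    using inner[of "norm a" _ "norm (f _)"]
    by (intro summable_on_SigmaI[where g = ?R] R)
       (auto intro!: mult_nonneg_nonneg order_trans[OF norm_ge_zero norm_coeff_split_le])
  then have "(\<lambda>p. norm (?H p)) summable_on Sigma ?Q (fibre 1 n)"
    by (rule Infinite_Sum.abs_summable_on_comparison_test')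
       (auto simp: norm_mult intro!: mult_right_mono norm_coeff_split_le)
  then have "(?H has_sum lauricella_FA n a b c x) (Sigma ?Q (fibre 1 n))"
    by (rule has_sum_SigmaI[OF _ G abs_summable_summable, rotated]) (simp only: prod.case inner)
  moreover have "((\<lambda>(m, p). coeff_split 1 n a m p * f (\<lambda>k. ?M m k + p k)) has_sum lauricella_FA n a b c x)
         (?X \<times> ?Q)
      \<longleftrightarrow> (?H has_sum lauricella_FA n a b c x) (Sigma ?Q (fibre 1 n))"
  proof (rule has_sum_reindex_bij_witness[where i = ?i and j = ?j])
    fix mp assume mp: "mp \<in> ?X \<times> ?Q"
    obtain m p where [simp]: "mp = (m, p)" by (cases mp)
    show "?i (?j mp) = mp"
      using mp by (auto simp: fun_eq_iff PiE_def extensional_def)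
    show "?j mp \<in> Sigma ?Q (fibre 1 n)"
      using mp by (auto simp: fibre_def)
    show "?H (?j mp) = (case mp of (m, p) \<Rightarrow> coeff_split 1 n a m p * f (\<lambda>k. ?M m k + p k))"
      by (simp add: coeff_split_def f_def)
  next
    fix qm assume qm: "qm \<in> Sigma ?Q (fibre 1 n)"
    obtain q m where [simp]: "qm = (q, m)" by (cases qm)
    show "?j (?i qm) = qm"
      using qm by (auto simp: fun_eq_iff PiE_def extensional_def fibre_def)
    show "?i qm \<in> ?X \<times> ?Q"
      using qm by (auto simp: fibre_def)
  qed auto
  ultimately show ?thesis by simp
qed

theorem mainTheorem1:
  fixes n :: nat and a :: complex and b c x :: "nat \<Rightarrow> complex"
  assumes "n \<ge> 1"
    and "\<And>k. k \<in> {1..n} \<Longrightarrow> c k \<notin> \<int>\<^sub>\<le>\<^sub>0"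
    and "(\<Sum>k=1..n. norm (x k)) < 1"
  shows "((\<lambda>m. pochhammer a (N2 m n n) / (\<Prod>p\<in>idx2 n. fact (m p)) *
            (\<Prod>k=1..n. pochhammer (b k) (M2 m k n) / pochhammer (c k) (M2 m k n) *
               x k ^ M2 m k n *
               gauss_F (a + of_nat (N2 m k n)) (b k + of_nat (M2 m k n))
                       (c k + of_nat (M2 m k n)) (x k)))
          has_sum lauricella_FA n a b c x) (idx2 n \<rightarrow>\<^sub>E (UNIV :: nat set))"
proof -
  have two: "Suc 1 = 2" by simp
  have from_2: "idx_from (Suc 1) n = idx2 n" "M_from (Suc 1) m k n = M2 m k n" "N_from (Suc 1) m k n = N2 m k n"
    for m k
    unfolding two by (simp_all add: idx_from_def idx2_def M_from_def M2_def N_from_def N2_def)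
  let ?Q = "{1..n} \<rightarrow>\<^sub>E (UNIV :: nat set)"
  let ?f = "\<lambda>q. \<Prod>k=1..n. pochhammer (b k) (q k) / pochhammer (c k) (q k) * x k ^ q k"
  let ?S = "\<lambda>m p. coeff_split 1 n a m p * ?f (\<lambda>k. M2 m k n + p k)"
  have total: "((\<lambda>(m, p). ?S m p) has_sum lauricella_FA n a b c x) ((idx2 n \<rightarrow>\<^sub>E UNIV) \<times> ?Q)"
    using lauricella_has_sum_split_exponents[OF assms, where a = a and b = b] unfolding from_2 .
  show ?thesis
  proof (rule has_sum_SigmaD[OF total], unfold prod.case)
    fix m :: "nat \<times> nat \<Rightarrow> nat" assume m: "m \<in> idx2 n \<rightarrow>\<^sub>E UNIV"
    let ?M = "\<lambda>k. M2 m k n" and ?N = "\<lambda>k. N2 m k n"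
    let ?W = "pochhammer a (?N n) / (\<Prod>p\<in>idx2 n. fact (m p)) *
        (\<Prod>k=1..n. pochhammer (b k) (?M k) / pochhammer (c k) (?M k) * x k ^ ?M k)"
    let ?h = "\<lambda>k j. pochhammer (a + of_nat (?N k)) j * pochhammer (b k + of_nat (?M k)) j /
        (fact j * pochhammer (c k + of_nat (?M k)) j) * x k ^ j"
    have S: "?S m p = ?W * (\<Prod>k=1..n. ?h k (p k))" for p
      unfolding coeff_split_def from_2
      by (simp add: pochhammer_product' power_add prod.distrib prod_dividef mult_ac)
    have c: "c k + of_nat (?M k) \<notin> \<int>\<^sub>\<le>\<^sub>0" if "k \<in> {1..n}" for k
    proof
      assume "c k + of_nat (?M k) \<in> \<int>\<^sub>\<le>\<^sub>0"
      then obtain i where "c k + of_nat (?M k) = - of_nat i"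
        by (rule nonpos_Ints_cases')
      then have "c k = - of_nat (i + ?M k)"
        by (simp add: algebra_simps)
      with assms(2)[OF that] show False
        by (metis minus_of_nat_in_nonpos_Ints)
    qed
    have x: "norm (x k) < 1" if "k \<in> {1..n}" for k
      using member_le_sum[of k "{1..n}" "\<lambda>k. norm (x k)"] that assms(3) by simp
    have "?S m summable_on ?Q"
      using total m by (intro summable_on_SigmaD1[where f = ?S]) (auto simp: summable_on_def)
    then have "(?S m has_sum infsum (?S m) ?Q) ?Q"
      by (rule has_sum_infsum)
    also have "infsum (?S m) ?Q = ?W * (\<Prod>k=1..n. infsum (?h k) UNIV)"
      unfolding S infsum_cmult_right'
      by (intro arg_cong2[of _ _ _ _ times] refl infsum_prod_PiE_abs gauss_F_infsum(1) c x) auto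
    also have "(\<Prod>k=1..n. infsum (?h k) UNIV)
        = (\<Prod>k=1..n. gauss_F (a + of_nat (?N k)) (b k + of_nat (?M k)) (c k + of_nat (?M k)) (x k))"
      by (intro prod.cong refl gauss_F_infsum(2) c x)
    finally show "(?S m has_sum pochhammer a (?N n) / (\<Prod>p\<in>idx2 n. fact (m p)) *
            (\<Prod>k=1..n. pochhammer (b k) (?M k) / pochhammer (c k) (?M k) * x k ^ ?M k *
               gauss_F (a + of_nat (?N k)) (b k + of_nat (?M k)) (c k + of_nat (?M k)) (x k))) ?Q"
      by (simp only: prod.distrib mult.assoc)
  qed
qed

end
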